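(* Let $r\ge 2$ and let $\delta_1,\delta_2$ be non-negative integers satisfying $\delta_1+\delta_2=\lfloor 3r/2\rfloor$, $\delta_1\le r$, and $\delta_2\le r$. Then there exist two edge-subgraphs $X$ and $Y$ of $K_{r,r}$ such that $\delta(X)=\delta_1$, $\delta(Y)=\delta_2$, and the friends-and-strangers graph $\mathsf{FS}(X,Y)$ has more than two connected components.
   Context: $K_{r,r}$ is the complete bipartite graph with two parts of size $r$; an edge-subgraph of $K_{r,r}$ is a graph on the same $2r$ vertices whose edge set is a subset of that of $K_{r,r}$. For a simple graph $G$, $\delta(G)$ denotes its minimum degree. For two simple graphs $X$ and $Y$ with the same finite number of vertices, the friends-and-strangers graph $\mathsf{FS}(X,Y)$ has as vertex set all bijections $\sigma:V(X)\to V(Y)$; two bijections $\sigma,\tau$ are adjacent if and only if there are distinct vertices $a,b\in V(X)$ with $\{a,b\}\in E(X)$, $\{\sigma(a),\sigma(b)\}\in E(Y)$, $\tau(a)=\sigma(b)$, $\tau(b)=\sigma(a)$, and $\tau(w)=\sigma(w)$ for all $w\in V(X)\setminus\{a,b\}$. *)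

theory Defs
  imports "Graph_Theory.Graph_Theory" "HOL-Library.FuncSet"
begin

text \<open>
  Finite simple graphs are the \<^locale>\<open>pair_graph\<close>s of the library: finite, loopless, symmetric
  digraphs without parallel arcs. An edge \<open>{u, v}\<close> is represented by the two arcs \<open>(u, v)\<close> and
  \<open>(v, u)\<close>.
\<close>

definition complete_bipartite :: "nat \<Rightarrow> nat \<Rightarrow> (nat + nat) pair_pre_digraph" where
  "complete_bipartite m n =
    \<lparr> pverts = {..<m} <+> {..<n},
      parcs = (Inl ` {..<m}) \<times> (Inr ` {..<n}) \<union> (Inr ` {..<n}) \<times> (Inl ` {..<m}) \<rparr>"

lemma complete_bipartite_digraph_complete_bipartite:
  "K\<^bsub>m,n\<^esub> (with_proj (complete_bipartite m n))"
  unfolding complete_bipartite_digraph_pair_def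
proof (intro conjI exI)
  show "pverts (complete_bipartite m n) = Inl ` {..<m} \<union> Inr ` {..<n}"
    by (auto simp: complete_bipartite_def)
qed (auto simp: complete_bipartite_def card_image)

definition edge_subgraph :: "'a pair_pre_digraph \<Rightarrow> 'a pair_pre_digraph \<Rightarrow> bool" where
  "edge_subgraph H G \<longleftrightarrow> pair_graph H \<and> spanning (with_proj H) (with_proj G)"

text \<open>By symmetry, the out-degree of a vertex of a simple graph is its degree.\<close>

definition min_degree :: "'a pair_pre_digraph \<Rightarrow> nat" where
  "min_degree G = Min (out_degree (with_proj G) ` pverts G)"

text \<open>
  Bijections are made extensional (\<^term>\<open>undefined\<close> outside \<^term>\<open>pverts X\<close>), so that functions
  which differ only outside \<^term>\<open>pverts X\<close> do not count as different vertices.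
\<close>

definition bijections :: "'a set \<Rightarrow> 'b set \<Rightarrow> ('a \<Rightarrow> 'b) set" where
  "bijections A B = {\<sigma> \<in> extensional A. bij_betw \<sigma> A B}"

definition FS :: "'a pair_pre_digraph \<Rightarrow> 'b pair_pre_digraph \<Rightarrow> ('a \<Rightarrow> 'b) pair_pre_digraph" where
  "FS X Y =
    \<lparr> pverts = bijections (pverts X) (pverts Y),
      parcs = {(\<sigma>, \<tau>).
        \<sigma> \<in> bijections (pverts X) (pverts Y) \<and> \<tau> \<in> bijections (pverts X) (pverts Y) \<and>
        (\<exists>a\<in>pverts X. \<exists>b\<in>pverts X. a \<noteq> b \<and> (a, b) \<in> parcs X \<and> (\<sigma> a, \<sigma> b) \<in> parcs Y \<and>
          \<tau> a = \<sigma> b \<and> \<tau> b = \<sigma> a \<and> (\<forall>w\<in>pverts X - {a, b}. \<tau> w = \<sigma> w))} \<rparr>"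

definition connected_components ::
    "'a pair_pre_digraph \<Rightarrow> ('a, 'a \<times> 'a) pre_digraph set" where
  "connected_components G = {H. pre_digraph.max_subgraph (with_proj G) connected H}"

lemma finite_bijections:
  assumes "finite A" "finite B"
  shows "finite (bijections A B)"
proof (rule finite_subset)
  show "bijections A B \<subseteq> (A \<rightarrow>\<^sub>E B)"
    by (auto simp: bijections_def PiE_def extensional_def bij_betw_def)
qed (use assms in \<open>simp add: finite_PiE\<close>)

lemma pair_graph_FS:
  assumes "pair_graph X" "pair_graph Y"
  shows "pair_graph (FS X Y)"
proof -
  interpret X: pair_graph X by fact
  interpret Y: pair_graph Y by fact
  have symX: "(b, a) \<in> parcs X" if "(a, b) \<in> parcs X" for a b
    using X.pair_sym_arcs that by (auto simp: symmetric_def sym_def)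
  have symY: "(b, a) \<in> parcs Y" if "(a, b) \<in> parcs Y" for a b
    using Y.pair_sym_arcs that by (auto simp: symmetric_def sym_def)
  have fin: "finite (pverts (FS X Y))"
    by (simp add: FS_def finite_bijections)
  have sub: "parcs (FS X Y) \<subseteq> pverts (FS X Y) \<times> pverts (FS X Y)"
    by (auto simp: FS_def)
  show ?thesis
  proof unfold_locales
    show "finite (parcs (FS X Y))"
      using finite_subset[OF sub] fin by simp
    show "symmetric (with_proj (FS X Y))"
      unfolding symmetric_def with_proj_simps
    proof (rule symI)
      fix \<sigma> \<tau> assume *: "(\<sigma>, \<tau>) \<in> parcs (FS X Y)"
      then obtain a b where "a \<in> pverts X" "b \<in> pverts X" "a \<noteq> b" "(a, b) \<in> parcs X"
        "(\<sigma> a, \<sigma> b) \<in> parcs Y" "\<tau> a = \<sigma> b" "\<tau> b = \<sigma> a" "\<forall>w\<in>pverts X - {a, b}. \<tau> w = \<sigma> w"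
        by (auto simp: FS_def)
      then have "\<exists>a\<in>pverts X. \<exists>b\<in>pverts X. a \<noteq> b \<and> (a, b) \<in> parcs X \<and> (\<tau> a, \<tau> b) \<in> parcs Y \<and>
          \<sigma> a = \<tau> b \<and> \<sigma> b = \<tau> a \<and> (\<forall>w\<in>pverts X - {a, b}. \<sigma> w = \<tau> w)"
        using symY by (intro bexI[of _ a] bexI[of _ b]) simp_all
      with * show "(\<tau>, \<sigma>) \<in> parcs (FS X Y)"
        by (simp add: FS_def)
    qed
    show "fst e \<noteq> snd e" if e: "e \<in> parcs (FS X Y)" for e
    proof
      assume eq: "fst e = snd e"
      obtain \<sigma> where e_eq: "e = (\<sigma>, \<sigma>)"
        using eq by (metis prod.collapse)
      obtain a b where "(\<sigma> a, \<sigma> b) \<in> parcs Y" "\<sigma> a = \<sigma> b"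
        using e unfolding e_eq FS_def pair_pre_digraph.simps mem_Collect_eq prod.case by blast
      then show False
        using Y.pair_no_loops[of "(\<sigma> a, \<sigma> b)"] by simp
    qed
  qed (use sub fin in auto)
qed

lemma connected_components_conv_sccs:
  assumes "pair_graph G"
  shows "connected_components G = pre_digraph.sccs (with_proj G)"
proof -
  interpret pair_graph G by fact
  have sym_induced: "symmetric (with_proj G \<restriction> S)" for S
    using pair_sym_arcs by (auto simp: symmetric_conv)
  have sc_conn: "connected H" if "strongly_connected H" for H :: "('a, 'a \<times> 'a) pre_digraph"
  proof -
    have "(u, v) \<in> rtrancl_on (verts H) ((arcs_ends H)\<^sup>s)"
      if "(u, v) \<in> rtrancl_on (verts H) (arcs_ends H)" for u v
      using rtrancl_on_mono that unfolding symcl_def by (metis Un_upper1 order_refl)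
    then show ?thesis
      using that by (auto simp: connected_conv strongly_connected_def reachable_def)
  qed
  have induced: "strongly_connected (with_proj G \<restriction> verts H)" "subgraph (with_proj G \<restriction> verts H) G"
      "subgraph H (with_proj G \<restriction> verts H)"
    if H: "subgraph H G" "connected H" for H
  proof -
    have V: "verts H \<subseteq> verts G"
      using H by (auto simp: subgraph_def)
    interpret I: wf_digraph "with_proj G \<restriction> verts H"
      by (rule wellformed_induce_subgraph)
    show "subgraph (with_proj G \<restriction> verts H) G"
      using V by (auto intro: induced_imp_subgraph)
    show sub: "subgraph H (with_proj G \<restriction> verts H)"
    proof -
      have "wf_digraph H" "arcs H \<subseteq> arcs G" "tail H = tail G" "head H = head G"
        using H by (auto simp: subgraph_def compatible_def)
      moreover from this have "arcs H \<subseteq> arcs (with_proj G \<restriction> verts H)"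
        using wf_digraph.tail_in_verts[of H] wf_digraph.head_in_verts[of H]
        by (fastforce simp: induce_subgraph_def)
      ultimately show ?thesis
        using I.wf_digraph by (auto simp: subgraph_def compatible_def)
    qed
    have "spanning H (with_proj G \<restriction> verts H)"
      using sub by (auto simp: spanning_def)
    then have "connected (with_proj G \<restriction> verts H)"
      using H by (intro I.connected_spanning_imp_connected)
    then show "strongly_connected (with_proj G \<restriction> verts H)"
      by (intro I.symmetric_connected_imp_strongly_connected sym_induced)
  qed
  have "max_subgraph connected H \<longleftrightarrow> max_subgraph strongly_connected H" for H
  proof
    assume H: "max_subgraph connected H"
    then have "subgraph H G" "connected H"
      by (auto simp: max_subgraph_def)
    note ind = induced[OF this]
    have max: "H' = H" if "subgraph H H'" "subgraph H' G" "connected H'" for H'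
      using H that unfolding max_subgraph_def by blast
    have eq: "with_proj G \<restriction> verts H = H"
      using ind(3,2) sc_conn[OF ind(1)] by (rule max)
    have "H' = H" if "subgraph H H'" "subgraph H' G" "strongly_connected H'" for H'
      using that(1,2) sc_conn[OF that(3)] by (rule max)
    moreover have "strongly_connected H"
      using ind(1) unfolding eq .
    ultimately show "max_subgraph strongly_connected H"
      using \<open>subgraph H G\<close> unfolding max_subgraph_def by blast
  next
    assume H: "max_subgraph strongly_connected H"
    have "\<not> (subgraph H' G \<and> connected H')" if H': "H' \<noteq> H" "subgraph H H'" for H'
    proof
      assume "subgraph H' G \<and> connected H'"
      then have ind: "strongly_connected (with_proj G \<restriction> verts H')"
          "subgraph (with_proj G \<restriction> verts H') G" "subgraph H' (with_proj G \<restriction> verts H')"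
        using induced by auto
      have "subgraph H (with_proj G \<restriction> verts H')"
        using H'(2) ind(3) by (rule subgraph_trans)
      then have "with_proj G \<restriction> verts H' = H"
        using H ind(1,2) unfolding max_subgraph_def by blast
      with ind(3) have "subgraph H' H"
        by (simp only:)
      with H'(2) have "H' = H"
        by (intro pre_digraph.equality) (auto simp: subgraph_def compatible_def)
      with H' show False by simp
    qed
    then show "max_subgraph connected H"
      using H sc_conn unfolding max_subgraph_def by blast
  qed
  then show ?thesis
    by (simp add: connected_components_def sccs_altdef2)
qed

end

theory Submission
  imports Defs
begin

text \<open>
  Split either side of \<open>K\<^bsub>r,r\<^esub>\<close> into the indices below \<open>p = \<lfloor>r/2\<rfloor>\<close> and the remaining \<open>q = r - p\<close>
  indices. Both graphs contain all edges between a low and a high index; between indices of the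
  same kind, \<open>X\<close> uses a regular bipartite graph and \<open>Y\<close> its complement. The bijection that exchanges
  the two sides on the high indices sends a mixed pair into one side of \<open>Y\<close> and an unmixed edge of
  \<open>X\<close> to a non-edge of \<open>Y\<close>, so it is an isolated vertex of the friends-and-strangers graph. The
  same holds for the bijection that exchanges the two sides on the low indices. With any third
  bijection this gives three components.
\<close>

section \<open>Components and isolated vertices\<close>

lemma (in pre_digraph) reachable_from_sink:
  assumes "u \<rightarrow>\<^sup>* v" and "\<And>w. \<not> u \<rightarrow> w"
  shows "u = v"
  using assms by (metis converse_reachable_cases)

text \<open>A vertex without outgoing arcs reaches only itself, so \<open>s\<close> and
  \<open>t\<close> form singleton components and neither lies in that of \<open>u\<close>. As the
  graph is symmetric, strong components may be counted instead.\<close>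

lemma card_connected_components_gt_2:
  assumes "pair_graph G" and verts: "s \<in> pverts G" "t \<in> pverts G" "u \<in> pverts G"
    and neq: "s \<noteq> t" "s \<noteq> u" "t \<noteq> u"
    and isolated: "\<And>w. (s, w) \<notin> parcs G" "\<And>w. (t, w) \<notin> parcs G"
  shows "card (connected_components G) > 2"
proof -
  interpret pair_graph G by fact
  have scc: "scc_of s = {s}" "scc_of t = {t}"
    using reachable_from_sink[of s] reachable_from_sink[of t] isolated verts
    by (auto simp: scc_of_def)
  have notin: "s \<notin> scc_of u" "t \<notin> scc_of u"
    using reachable_from_sink[of s u] reachable_from_sink[of t u] isolated neq
    by (auto simp: scc_of_def)
  have "{scc_of s, scc_of t, scc_of u} \<subseteq> sccs_verts"
    using scc_of_in_sccs_verts verts by simp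
  then have "card {scc_of s, scc_of t, scc_of u} \<le> card sccs_verts"
    by (rule card_mono[OF finite_sccs_verts])
  moreover have "scc_of s \<noteq> scc_of t" "scc_of s \<noteq> scc_of u" "scc_of t \<noteq> scc_of u"
    using scc notin neq by blast+
  then have "card {scc_of s, scc_of t, scc_of u} = 3"
    by simp
  ultimately show ?thesis
    using connected_components_conv_sccs[OF assms(1)] card_sccs_verts by simp
qed

section \<open>Edge-subgraphs of the complete bipartite graph\<close>

text \<open>For symmetric \<open>P\<close>, exchanging \<open>Inl i\<close> and \<open>Inr i\<close>
  is an automorphism, so both sides have the same degrees.\<close>

definition bipartite_graph :: "nat \<Rightarrow> (nat \<Rightarrow> nat \<Rightarrow> bool) \<Rightarrow> (nat + nat) pair_pre_digraph" where
  "bipartite_graph r P =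
    \<lparr> pverts = {..<r} <+> {..<r},
      parcs = {(Inl i, Inr j) |i j. i < r \<and> j < r \<and> P i j} \<union>
        {(Inr j, Inl i) |i j. i < r \<and> j < r \<and> P i j} \<rparr>"

lemma pverts_bipartite_graph: "pverts (bipartite_graph r P) = {..<r} <+> {..<r}"
  by (simp add: bipartite_graph_def)

lemma parcs_bipartite_graph_iff:
  "(Inl i, Inr j) \<in> parcs (bipartite_graph r P) \<longleftrightarrow> i < r \<and> j < r \<and> P i j"
  "(Inr j, Inl i) \<in> parcs (bipartite_graph r P) \<longleftrightarrow> i < r \<and> j < r \<and> P i j"
  "(Inl i, Inl i') \<notin> parcs (bipartite_graph r P)"
  "(Inr j, Inr j') \<notin> parcs (bipartite_graph r P)"
  by (auto simp: bipartite_graph_def)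

lemma bipartite_graph_subset:
  "parcs (bipartite_graph r P) \<subseteq> parcs (complete_bipartite r r)"
  by (auto simp: bipartite_graph_def complete_bipartite_def)

lemma pair_graph_bipartite_graph: "pair_graph (bipartite_graph r P)"
proof unfold_locales
  show "finite (parcs (bipartite_graph r P))"
    by (rule finite_subset[OF bipartite_graph_subset]) (simp add: complete_bipartite_def)
  show "symmetric (with_proj (bipartite_graph r P))"
    by (auto simp: symmetric_def sym_def bipartite_graph_def)
qed (auto simp: bipartite_graph_def)

lemma edge_subgraph_bipartite_graph:
  "edge_subgraph (bipartite_graph r P) (complete_bipartite r r)"
proof -
  interpret X: pair_graph "bipartite_graph r P"
    by (rule pair_graph_bipartite_graph)
  have "wf_digraph (with_proj (complete_bipartite r r))"
    by unfold_locales (auto simp: complete_bipartite_def)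
  moreover have "pverts (bipartite_graph r P) = pverts (complete_bipartite r r)"
    by (simp add: bipartite_graph_def complete_bipartite_def)
  ultimately show ?thesis
    using bipartite_graph_subset X.pair_graph_axioms X.wf_digraph_axioms
    by (auto simp: edge_subgraph_def spanning_def subgraph_def compatible_def)
qed

lemma out_degree_bipartite_graph:
  assumes "i < r" and sym: "\<And>i j. P i j \<longleftrightarrow> P j i"
  shows "out_degree (with_proj (bipartite_graph r P)) (Inl i) = card {j. j < r \<and> P i j}"
    and "out_degree (with_proj (bipartite_graph r P)) (Inr i) = card {j. j < r \<and> P i j}"
proof -
  have "out_arcs (with_proj (bipartite_graph r P)) (Inl i) =
      (\<lambda>j. (Inl i, Inr j)) ` {j. j < r \<and> P i j}"
    using \<open>i < r\<close> by (auto simp: out_arcs_def bipartite_graph_def)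
  then show "out_degree (with_proj (bipartite_graph r P)) (Inl i) = card {j. j < r \<and> P i j}"
    by (simp add: out_degree_def card_image inj_on_def)
  have "out_arcs (with_proj (bipartite_graph r P)) (Inr i) =
      (\<lambda>j. (Inr i, Inl j)) ` {j. j < r \<and> P i j}"
    using \<open>i < r\<close> sym by (auto simp: out_arcs_def bipartite_graph_def)
  then show "out_degree (with_proj (bipartite_graph r P)) (Inr i) = card {j. j < r \<and> P i j}"
    by (simp add: out_degree_def card_image inj_on_def)
qed

lemma min_degree_bipartite_graph:
  assumes sym: "\<And>i j. P i j \<longleftrightarrow> P j i"
    and ge: "\<And>i. i < r \<Longrightarrow> n \<le> card {j. j < r \<and> P i j}"
    and eq: "i < r" "card {j. j < r \<and> P i j} = n"
  shows "min_degree (bipartite_graph r P) = n"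
  unfolding min_degree_def
proof (rule Min_eqI)
  show "finite (out_degree (with_proj (bipartite_graph r P)) ` pverts (bipartite_graph r P))"
    by (simp add: pverts_bipartite_graph)
  show "n \<le> k" if "k \<in> out_degree (with_proj (bipartite_graph r P)) ` pverts (bipartite_graph r P)"
    for k
    using that ge out_degree_bipartite_graph[OF _ sym] by (auto simp: pverts_bipartite_graph)
  show "n \<in> out_degree (with_proj (bipartite_graph r P)) ` pverts (bipartite_graph r P)"
    using eq out_degree_bipartite_graph(1)[OF eq(1) sym]
    by (auto simp: pverts_bipartite_graph intro!: rev_image_eqI[of "Inl i"])
qed

section \<open>Two isolated bijections\<close>

definition swap_sides :: "nat \<Rightarrow> (nat \<Rightarrow> bool) \<Rightarrow> nat + nat \<Rightarrow> nat + nat" where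
  "swap_sides r A = restrict (case_sum (\<lambda>i. if A i then Inr i else Inl i)
    (\<lambda>i. if A i then Inl i else Inr i)) ({..<r} <+> {..<r})"

lemma swap_sides_simps:
  assumes "i < r"
  shows "swap_sides r A (Inl i) = (if A i then Inr i else Inl i)"
    and "swap_sides r A (Inr i) = (if A i then Inl i else Inr i)"
  using assms by (auto simp: swap_sides_def)

lemma swap_sides_in_bijections:
  "swap_sides r A \<in> bijections ({..<r} <+> {..<r}) ({..<r} <+> {..<r})"
proof -
  have "bij_betw (swap_sides r A) ({..<r} <+> {..<r}) ({..<r} <+> {..<r})"
    by (rule bij_betw_byWitness[where f' = "swap_sides r A"]) (auto simp: swap_sides_simps)
  then show ?thesis
    by (simp add: bijections_def swap_sides_def)
qed

text \<open>Take an edge between \<open>Inl i\<close> and \<open>Inr j\<close>. If \<open>A\<close>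
  separates \<open>i\<close> from \<open>j\<close>, both images lie on one side. Otherwise the
  images are adjacent only if \<open>Q i j\<close> (neither moved) or \<open>Q j i\<close> (both
  moved); \<open>mixed\<close> excludes the first, and with symmetry of \<open>P\<close> also the
  second.\<close>

lemma swap_sides_isolated:
  assumes sym: "\<And>i j. P i j \<longleftrightarrow> P j i"
    and mixed: "\<And>i j. P i j \<Longrightarrow> Q i j \<Longrightarrow> A i \<noteq> A j"
  shows "(swap_sides r A, \<tau>) \<notin> parcs (FS (bipartite_graph r P) (bipartite_graph r Q))"
proof
  assume "(swap_sides r A, \<tau>) \<in> parcs (FS (bipartite_graph r P) (bipartite_graph r Q))"
  then obtain a b where "(a, b) \<in> parcs (bipartite_graph r P)"
    "(swap_sides r A a, swap_sides r A b) \<in> parcs (bipartite_graph r Q)"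
    by (auto simp: FS_def)
  then show False
    using sym mixed
    by (cases a; cases b)
      (auto simp: parcs_bipartite_graph_iff swap_sides_simps split: if_splits)
qed

lemma card_components_FS_bipartite_graph:
  assumes "\<And>i j. P i j \<longleftrightarrow> P j i" and "\<And>i j. P i j \<Longrightarrow> Q i j \<Longrightarrow> A i \<noteq> A j"
    and "i < r" "A i" "j < r" "\<not> A j"
  shows "card (connected_components (FS (bipartite_graph r P) (bipartite_graph r Q))) > 2"
proof (rule card_connected_components_gt_2)
  show "pair_graph (FS (bipartite_graph r P) (bipartite_graph r Q))"
    by (intro pair_graph_FS pair_graph_bipartite_graph)
  \<comment> \<open>The condition on \<open>A\<close> is invariant under complement, which gives
    \<open>?t\<close>; \<open>?u\<close> is the identity on the vertices.\<close>
  let ?s = "swap_sides r A" and ?t = "swap_sides r (\<lambda>i. \<not> A i)" and ?u = "swap_sides r (\<lambda>_. False)"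
  show "(?s, w) \<notin> parcs (FS (bipartite_graph r P) (bipartite_graph r Q))"
    and "(?t, w) \<notin> parcs (FS (bipartite_graph r P) (bipartite_graph r Q))" for w
    by (rule swap_sides_isolated[OF assms(1)], use assms(2) in blast)+
  have "?s (Inl i) = Inr i" "?t (Inl i) = Inl i" "?u (Inl i) = Inl i" "?t (Inl j) = Inr j"
    "?u (Inl j) = Inl j"
    using assms by (simp_all add: swap_sides_simps)
  then show "?s \<noteq> ?t" "?s \<noteq> ?u" "?t \<noteq> ?u"
    by (metis sum.distinct(1))+
qed (simp_all add: FS_def pverts_bipartite_graph swap_sides_in_bijections)

section \<open>The degrees\<close>

text \<open>Two members of a window of length \<open>m\<close> differ by less than \<open>m\<close>,
  so their residues are distinct; counting gives surjectivity.\<close>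

lemma bij_betw_add_mod:
  fixes c i m :: nat
  shows "bij_betw (\<lambda>j. (i + j) mod m) {c..<c + m} {..<m}"
proof -
  have less: "(i + j) mod m \<noteq> (i + k) mod m" if "c \<le> j" "j < k" "k < c + m" for j k
  proof
    assume "(i + j) mod m = (i + k) mod m"
    then have "m dvd k - j"
      using that mod_eq_dvd_iff_nat[of "i + j" "i + k" m] by simp
    then show False
      using that dvd_imp_le[of m "k - j"] by simp
  qed
  then have inj: "inj_on (\<lambda>j. (i + j) mod m) {c..<c + m}"
    by (intro linorder_inj_onI) auto
  moreover have "(\<lambda>j. (i + j) mod m) ` {c..<c + m} = {..<m}"
    by (rule card_subset_eq) (auto simp: card_image[OF inj])
  ultimately show ?thesis
    by (simp add: bij_betw_def)
qed

text \<open>This is the regularity of the circulant relation and of its complement. The offset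
  \<open>c\<close> is 0 for low and \<open>p\<close> for high indices.\<close>

lemma card_add_mod:
  fixes c i m e :: nat
  assumes "e \<le> m"
  shows "card {j \<in> {c..<c + m}. (i + j) mod m < e} = e"
    and "card {j \<in> {c..<c + m}. \<not> (i + j) mod m < e} = m - e"
proof -
  have card: "card {j \<in> {c..<c + m}. (i + j) mod m \<in> S} = card S" if "S \<subseteq> {..<m}" for S
  proof -
    have "(\<lambda>j. (i + j) mod m) ` {j \<in> {c..<c + m}. (i + j) mod m \<in> S} =
        (\<lambda>j. (i + j) mod m) ` {c..<c + m} \<inter> S"
      by blast
    also have "\<dots> = S"
      using bij_betw_add_mod[of i m c] that by (auto simp: bij_betw_def)
    finally have "(\<lambda>j. (i + j) mod m) ` {j \<in> {c..<c + m}. (i + j) mod m \<in> S} = S" .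
    moreover have "inj_on (\<lambda>j. (i + j) mod m) {j \<in> {c..<c + m}. (i + j) mod m \<in> S}"
      by (rule inj_on_subset[OF bij_betw_imp_inj_on[OF bij_betw_add_mod]]) auto
    ultimately show ?thesis
      by (metis card_image)
  qed
  show "card {j \<in> {c..<c + m}. (i + j) mod m < e} = e"
    using card[of "{..<e}"] assms by simp
  have "{j \<in> {c..<c + m}. \<not> (i + j) mod m < e} = {j \<in> {c..<c + m}. (i + j) mod m \<in> {e..<m}}"
    by auto
  also have "card \<dots> = card {e..<m}"
    by (rule card) auto
  finally show "card {j \<in> {c..<c + m}. \<not> (i + j) mod m < e} = m - e"
    by simp
qed

text \<open>Using the sum \<open>i + j\<close> makes the relation symmetric within each kind. Its
  values on mixed pairs are irrelevant, since such pairs are always joined.\<close>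

definition block :: "nat \<Rightarrow> nat \<Rightarrow> nat \<Rightarrow> nat \<Rightarrow> nat \<Rightarrow> nat \<Rightarrow> bool" where
  "block p q d e i j \<longleftrightarrow> (if i < p then (i + j) mod p < d else (i + j) mod q < e)"

text \<open>The form \<open>{0..<0 + p}\<close> is the window of \<open>card_add_mod\<close> at
  offset 0.\<close>

lemma card_mixed_or:
  fixes p q i :: nat
  assumes "i < p + q"
  shows "card {j. j < p + q \<and> ((i < p) \<noteq> (j < p) \<or> R j)} =
    (if i < p then q + card {j \<in> {0..<0 + p}. R j} else p + card {j \<in> {p..<p + q}. R j})"
proof (cases "i < p")
  case True
  then have "{j. j < p + q \<and> ((i < p) \<noteq> (j < p) \<or> R j)} = {p..<p + q} \<union> {j \<in> {0..<0 + p}. R j}"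
    by auto
  moreover have "card \<dots> = q + card {j \<in> {0..<0 + p}. R j}"
    by (subst card_Un_disjoint) auto
  ultimately show ?thesis
    using True by simp
next
  case False
  then have "{j. j < p + q \<and> ((i < p) \<noteq> (j < p) \<or> R j)} = {..<p} \<union> {j \<in> {p..<p + q}. R j}"
    by auto
  moreover have "card \<dots> = p + card {j \<in> {p..<p + q}. R j}"
    by (subst card_Un_disjoint) auto
  ultimately show ?thesis
    using False by simp
qed

lemma card_mixed_or_block:
  assumes "i < p + q" "d \<le> p" "e \<le> q"
  shows "card {j. j < p + q \<and> ((i < p) \<noteq> (j < p) \<or> block p q d e i j)} =
      (if i < p then q + d else p + e)"
    and "card {j. j < p + q \<and> ((i < p) \<noteq> (j < p) \<or> \<not> block p q d e i j)} =
      (if i < p then q + (p - d) else p + (q - e))"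
  using card_mixed_or[OF assms(1), of "block p q d e i"]
    card_mixed_or[OF assms(1), of "\<lambda>j. \<not> block p q d e i j"]
    card_add_mod[OF assms(2), of 0 i] card_add_mod[OF assms(3), of p i]
  by (simp_all add: block_def)

theorem theorem1p11:
  fixes r \<delta>\<^sub>1 \<delta>\<^sub>2 :: nat
  assumes "r \<ge> 2"
    and "\<delta>\<^sub>1 + \<delta>\<^sub>2 = (3 * r) div 2"
    and "\<delta>\<^sub>1 \<le> r"
    and "\<delta>\<^sub>2 \<le> r"
  shows "\<exists>X Y. edge_subgraph X (complete_bipartite r r) \<and> edge_subgraph Y (complete_bipartite r r) \<and>
    min_degree X = \<delta>\<^sub>1 \<and> min_degree Y = \<delta>\<^sub>2 \<and>
    card (connected_components (FS X Y)) > 2"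
proof -
  define p q where "p = r div 2" and "q = r - p"
  \<comment> \<open>A high index has \<open>p\<close> low neighbours and needs \<open>e\<close> high
    ones. The subtraction is not truncated: \<delta>2 \<le> r and the sum r + p force \<delta>1
    \<ge> p.\<close>
  define e where "e = \<delta>\<^sub>1 - p"
  \<comment> \<open>For odd \<open>r\<close>, \<open>e\<close> can be p + 1, more than the low block
    can supply.\<close>
  define d where "d = min e p"
  have r: "r = p + q" and pq: "0 < p" "p \<le> q" "q \<le> p + 1" and sum: "\<delta>\<^sub>1 + \<delta>\<^sub>2 = r + p"
    using assms by (auto simp: p_def q_def)
  have d\<^sub>1: "\<delta>\<^sub>1 = p + e" and d\<^sub>2: "\<delta>\<^sub>2 = p + (q - e)" and le: "d \<le> p" "e \<le> q"
    using assms(3,4) r sum by (auto simp: e_def d_def)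
  \<comment> \<open>Low indices have at least the degree of high ones in both graphs, so the high
    index \<open>p\<close> attains both minima. If e > p, then e = q = p + 1 and d = p, with
    equality in the first bound.\<close>
  have ge: "p + e \<le> q + d" "p + (q - e) \<le> q + (p - d)"
    using pq le by (auto simp: d_def)
  define P where "P i j \<longleftrightarrow> (i < p) \<noteq> (j < p) \<or> block p q d e i j" for i j
  define Q where "Q i j \<longleftrightarrow> (i < p) \<noteq> (j < p) \<or> \<not> block p q d e i j" for i j
  have sym: "P i j \<longleftrightarrow> P j i" "Q i j \<longleftrightarrow> Q j i" for i j
    by (auto simp: P_def Q_def block_def add.commute)
  have card: "card {j. j < r \<and> P i j} = (if i < p then q + d else p + e)"
    "card {j. j < r \<and> Q i j} = (if i < p then q + (p - d) else p + (q - e))" if "i < r" for i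
    using card_mixed_or_block[of i p q d e] that le by (simp_all add: P_def Q_def r)
  have "min_degree (bipartite_graph r P) = \<delta>\<^sub>1"
    by (rule min_degree_bipartite_graph[where i = p, OF sym(1)])
      (use card(1) ge r pq d\<^sub>1 in auto)
  moreover have "min_degree (bipartite_graph r Q) = \<delta>\<^sub>2"
    by (rule min_degree_bipartite_graph[where i = p, OF sym(2)])
      (use card(2) ge r pq d\<^sub>2 in auto)
  \<comment> \<open>\<open>P\<close> and \<open>Q\<close> hold together only on mixed pairs, because
    \<open>block\<close> is negated in \<open>Q\<close>. The indices \<open>p\<close> and 0
    represent the two kinds.\<close>
  moreover have "card (connected_components (FS (bipartite_graph r P) (bipartite_graph r Q))) > 2"
    by (rule card_components_FS_bipartite_graph[where A = "\<lambda>i. p \<le> i" and i = p and j = 0, OF sym(1)])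
      (use pq r in \<open>auto simp: P_def Q_def\<close>)
  ultimately show ?thesis
    using edge_subgraph_bipartite_graph by blast
qed

end
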